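(* Let $d\ge 1$ be a fixed integer and let $\epsilon>0$. Let $S=\{p_1,\dots,p_n\}$ be a set of $n$ points sampled independently and uniformly at random from the $d$-dimensional unit ball in $\mathbb{R}^d$. Then, with probability at least $1-O\left(\frac{1}{n^{\epsilon}}\right)$, the points of $S$ can be rounded to a grid of step size $1/n^{d+1+\epsilon}$ without changing their chirotope. That is, with at least this probability, if $p_i'$ denotes a point of the grid $\frac{1}{n^{d+1+\epsilon}}\mathbb{Z}^d$ nearest to $p_i$ for each $i$, then for every ordered $(d+1)$-tuple $(i_1,\dots,i_{d+1})$ of distinct indices in $\{1,\dots,n\}$ one has $\chi(p_{i_1}',\dots,p_{i_{d+1}}')=\chi(p_{i_1},\dots,p_{i_{d+1}})$. The constant implied by the $O$ notation may depend on $d$ but not on $n$.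
   Context: For an ordered $(d+1)$-tuple $(x_1,\dots,x_{d+1})$ of points of $\mathbb{R}^d$, with $x_k=(x_{k,1},\dots,x_{k,d})$, the orientation $\chi(x_1,\dots,x_{d+1})$ is the sign of the determinant of the $(d+1)\times(d+1)$ matrix whose $k$-th row is $(x_{k,1},x_{k,2},\dots,x_{k,d},1)$. The chirotope of a finite point set in general position (no $d+1$ points on a common hyperplane) is the map $\chi$ restricted to ordered $(d+1)$-tuples of distinct points of the set. A uniform sample is in general position almost surely. Rounding a point to a grid of step size $1/M$ means replacing it by a nearest point of the grid $\frac{1}{M}\mathbb{Z}^d$. Rounding leaves the chirotope unchanged if every ordered $(d+1)$-tuple of distinct sample points has the same orientation as the corresponding tuple of rounded points. *)

theory Defs
  imports "HOL-Probability.Probability"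
begin

text \<open>
  The dimension is \<open>d = CARD('d)\<close>. Both the members of a \<open>(d + 1)\<close>-tuple and the columns of the
  matrix are indexed by \<^typ>\<open>'d option\<close>, with \<^const>\<open>None\<close> the column of ones. For every
  enumeration of \<^typ>\<open>'d option\<close> that lists \<^const>\<open>None\<close> last, used for rows and columns alike,
  this is the matrix with rows \<open>(x\<^sub>k\<^sub>,\<^sub>1, \<dots>, x\<^sub>k\<^sub>,\<^sub>d, 1)\<close>; the determinant does not depend on the
  enumeration, since rows and columns are permuted simultaneously.
\<close>

definition orientation :: "('d::finite option \<Rightarrow> real ^ 'd) \<Rightarrow> real" where
  "orientation x = sgn (det (\<chi> k j. case j of Some i \<Rightarrow> x k $ i | None \<Rightarrow> 1))"

definition same_chirotope :: "'i set \<Rightarrow> ('i \<Rightarrow> real ^ 'd::finite) \<Rightarrow> ('i \<Rightarrow> real ^ 'd) \<Rightarrow> bool" where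
  "same_chirotope I p q \<longleftrightarrow>
     (\<forall>s :: 'd option \<Rightarrow> 'i. inj s \<and> range s \<subseteq> I \<longrightarrow>
        orientation (\<lambda>k. q (s k)) = orientation (\<lambda>k. p (s k)))"

definition grid :: "real \<Rightarrow> (real ^ 'd::finite) set" where
  "grid h = {x. \<forall>j. \<exists>z::int. x $ j = h * of_int z}"

text \<open>A nearest grid point need not be unique, so rounding is a relation.\<close>

definition rounds_to :: "real \<Rightarrow> real ^ 'd::finite \<Rightarrow> real ^ 'd \<Rightarrow> bool" where
  "rounds_to h x y \<longleftrightarrow> is_arg_min (dist x) (\<lambda>g. g \<in> grid h) y"

definition uniform_ball :: "(real ^ 'd::finite) measure" where
  "uniform_ball = uniform_measure lborel (cball 0 1)"

definition uniform_sample :: "nat \<Rightarrow> (nat \<Rightarrow> real ^ 'd::finite) measure" where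
  "uniform_sample n = PiM {1..n} (\<lambda>_. uniform_ball)"

end

theory Submission
  imports Defs
begin

text \<open>
  Rounding moves each coordinate by \<open>O(h)\<close>, hence the determinant by \<open>O(h)\<close>, so an orientation can
  change only if the determinant is \<open>O(h)\<close>. For a fixed tuple this has probability \<open>O(h)\<close>, and
  with \<open>h = n\<^bsup>-(d+1+\<epsilon>)\<^esup>\<close> the union bound over at most \<open>n\<^bsup>d+1\<^esup>\<close> tuples gives \<open>O(n\<^bsup>-\<epsilon>\<^esup>)\<close>.

  For the small-ball estimate, reveal the points one by one and let \<open>W\<^sub>k\<close> be the largest absolute value
  of a \<open>k\<close>-row minor (containing the column of ones) of the first \<open>k\<close> rows. Once all
  rows but one are known, the determinant is affine in the last point, with slope \<open>\<plusminus> W\<^sub>d\<close> in some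
  coordinate, so its absolute value is at most \<open>\<delta>\<close> with conditional probability \<open>O(\<delta> / W\<^sub>d)\<close>. It remains to see that
  \<open>1 / W\<^sub>d\<close> is integrable. While at least two rows are missing, two minors \<open>u\<close>, \<open>v\<close> of the next size
  vary independently with slope \<open>W\<^sub>k\<close> in two different coordinates, and
  \<open>1 / W\<^sub>k\<^sub>+\<^sub>1 \<le> \<bar>u\<bar>\<^bsup>-1/2\<^esup> \<bar>v\<bar>\<^bsup>-1/2\<^esup>\<close> has conditional expectation \<open>O(1 / W\<^sub>k)\<close>.
\<close>

section \<open>Averaging over shifts in the unit ball\<close>

text \<open>Translation invariance of the Lebesgue measure, averaged over the segment \<open>[0, 1] e\<close>. It replaces
  integration over a single coordinate, so that no coordinate system has to be split off.\<close>

lemma nn_integral_cball_le_average: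
  fixes F :: "'a::euclidean_space \<Rightarrow> ennreal"
  assumes [measurable]: "F \<in> borel_measurable borel" and e: "norm e \<le> 1"
  shows "(\<integral>\<^sup>+z. F z * indicator (cball 0 r) z \<partial>lborel)
    \<le> (\<integral>\<^sup>+z. (\<integral>\<^sup>+t. F (z + t *\<^sub>R e) * indicator {0..1} t \<partial>lborel) * indicator (cball 0 (r + 1)) z \<partial>lborel)"
proof -
  have [measurable]: "cball (0 :: 'a) s \<in> sets borel" for s
    by simp
  have shift: "(\<integral>\<^sup>+z. F z * indicator (cball 0 r) z \<partial>lborel)
      = (\<integral>\<^sup>+z. F (z + t *\<^sub>R e) * indicator (cball 0 r) (z + t *\<^sub>R e) \<partial>lborel)" for t :: real
  proof -
    have g: "(\<lambda>z. F z * indicator (cball 0 r) z) \<in> borel_measurable borel"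
      by measurable
    have "(\<integral>\<^sup>+z. F z * indicator (cball 0 r) z \<partial>lborel)
        = (\<integral>\<^sup>+z. F z * indicator (cball 0 r) z \<partial>distr lborel borel ((+) (t *\<^sub>R e)))"
      by (simp only: lborel_distr_plus)
    also have "\<dots> = (\<integral>\<^sup>+z. F (t *\<^sub>R e + z) * indicator (cball 0 r) (t *\<^sub>R e + z) \<partial>lborel)"
      by (rule nn_integral_distr) (simp_all add: g)
    finally show ?thesis
      by (simp only: add.commute)
  qed
  have "(\<integral>\<^sup>+z. F z * indicator (cball 0 r) z \<partial>lborel)
      = (\<integral>\<^sup>+t. (\<integral>\<^sup>+z. F z * indicator (cball 0 r) z \<partial>lborel) * indicator {0..1::real} t \<partial>lborel)"
    by (simp add: nn_integral_cmult)
  also have "\<dots> = (\<integral>\<^sup>+t. (\<integral>\<^sup>+z. F (z + t *\<^sub>R e) * indicator (cball 0 r) (z + t *\<^sub>R e)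
                      * indicator {0..1::real} t \<partial>lborel) \<partial>lborel)"
    by (intro nn_integral_cong) (subst nn_integral_multc, measurable, subst shift, rule refl)
  also have "\<dots> \<le> (\<integral>\<^sup>+t. (\<integral>\<^sup>+z. F (z + t *\<^sub>R e) * indicator {0..1::real} t
                      * indicator (cball 0 (r + 1)) z \<partial>lborel) \<partial>lborel)"
  proof (intro nn_integral_mono)
    fix t :: real and z :: 'a
    show "F (z + t *\<^sub>R e) * indicator (cball 0 r) (z + t *\<^sub>R e) * indicator {0..1} t
        \<le> F (z + t *\<^sub>R e) * indicator {0..1} t * indicator (cball 0 (r + 1)) z"
    \<comment> \<open>The shift has norm at most 1, so \<open>z\<close> stays within radius
      \<open>r + 1\<close>; otherwise the left-hand side is 0.\<close>
    proof (cases "t \<in> {0..1} \<and> z + t *\<^sub>R e \<in> cball 0 r")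
      case True
      have "norm (t *\<^sub>R e) \<le> 1"
        using True e by (auto intro: mult_le_one)
      moreover have "norm z \<le> norm (z + t *\<^sub>R e) + norm (t *\<^sub>R e)"
        by (metis add_diff_cancel_right' norm_triangle_ineq4)
      ultimately show ?thesis
        using True by auto
    qed auto
  qed
  also have "\<dots> = (\<integral>\<^sup>+z. (\<integral>\<^sup>+t. F (z + t *\<^sub>R e) * indicator {0..1::real} t
                      * indicator (cball 0 (r + 1)) z \<partial>lborel) \<partial>lborel)"
    by (rule lborel_pair.Fubini') measurable
  also have "\<dots> = (\<integral>\<^sup>+z. (\<integral>\<^sup>+t. F (z + t *\<^sub>R e) * indicator {0..1} t \<partial>lborel)
                      * indicator (cball 0 (r + 1)) z \<partial>lborel)"
    by (subst nn_integral_multc) auto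
  finally show ?thesis .
qed

lemma sets_uniform_ball [measurable_cong, simp]: "sets uniform_ball = sets borel"
  and space_uniform_ball [simp]: "space uniform_ball = UNIV"
  by (simp_all add: uniform_ball_def)

lemma emeasure_cball_pos: "r > 0 \<Longrightarrow> emeasure lborel (cball (0 :: 'a::euclidean_space) r) > 0"
  by (simp add: emeasure_cball ennreal_zero_less_mult_iff)

lemma prob_space_uniform_ball: "prob_space (uniform_ball :: (real ^ 'd::finite) measure)"
  unfolding uniform_ball_def
  using emeasure_cball_pos[of 1, where 'a = "real ^ 'd"] emeasure_lborel_cball_finite[of "0::real^'d" 1]
  by (intro prob_space_uniform_measure) auto

text \<open>The radius grows from 1 to 3 because two unit shifts are averaged, each enlarging the
  ball by 1. The ratio converts Lebesgue bounds on the large ball into bounds for the uniform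
  measure.\<close>

definition ball_ratio :: "'d::finite itself \<Rightarrow> ennreal" where
  "ball_ratio _ = emeasure lborel (cball (0 :: real ^ 'd) 3) / emeasure lborel (cball (0 :: real ^ 'd) 1)"

lemma ball_ratio_finite: "ball_ratio TYPE('d::finite) < \<infinity>"
  using emeasure_cball_pos[of 1, where 'a = "real ^ 'd"] emeasure_lborel_cball_finite[of "0::real^'d" 3]
  by (auto simp: ball_ratio_def ennreal_divide_eq_top_iff simp flip: less_top)

text \<open>Averaging along \<open>a\<close> and then along \<open>b\<close> enlarges the radius
  from 1 to 2 to 3. The double average is bounded uniformly in \<open>z\<close>, so \<open>c\<close>
  can be pulled out; normalising by the volume of the unit ball leaves
  \<open>ball_ratio\<close>.\<close>

lemma nn_integral_uniform_ball_le_average: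
  fixes F :: "real ^ 'd::finite \<Rightarrow> ennreal"
  assumes [measurable]: "F \<in> borel_measurable borel" and a: "norm a \<le> 1" and b: "norm b \<le> 1"
    and c: "\<And>z. (\<integral>\<^sup>+s. (\<integral>\<^sup>+t. F (z + s *\<^sub>R b + t *\<^sub>R a) * indicator {0..1} t \<partial>lborel)
                   * indicator {0..1} s \<partial>lborel) \<le> c"
  shows "(\<integral>\<^sup>+z. F z \<partial>uniform_ball) \<le> ball_ratio TYPE('d) * c"
proof -
  define G where "G z = (\<integral>\<^sup>+t. F (z + t *\<^sub>R a) * indicator {0..1} t \<partial>lborel)" for z
  have [measurable]: "G \<in> borel_measurable borel"
    unfolding G_def by measurable
  have "(\<integral>\<^sup>+z. F z * indicator (cball 0 1) z \<partial>lborel)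
      \<le> (\<integral>\<^sup>+z. G z * indicator (cball 0 2) z \<partial>lborel)"
    using nn_integral_cball_le_average[OF assms(1) a, of 1] by (simp add: G_def)
  also have "\<dots> \<le> (\<integral>\<^sup>+z. (\<integral>\<^sup>+s. G (z + s *\<^sub>R b) * indicator {0..1} s \<partial>lborel)
                     * indicator (cball 0 3) z \<partial>lborel)"
    using nn_integral_cball_le_average[of G b 2] b by simp
  also have "\<dots> \<le> (\<integral>\<^sup>+z. c * indicator (cball (0 :: real ^ 'd) 3) z \<partial>lborel)"
    unfolding G_def by (rule nn_integral_mono, rule mult_right_mono[OF c]) auto
  also have "\<dots> = c * emeasure lborel (cball (0 :: real ^ 'd) 3)"
    by (intro nn_integral_cmult_indicator) simp
  finally have "(\<integral>\<^sup>+z. F z * indicator (cball 0 1) z \<partial>lborel) \<le> \<dots>" .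
  then have "(\<integral>\<^sup>+z. F z * indicator (cball 0 1) z \<partial>lborel) / emeasure lborel (cball (0 :: real ^ 'd) 1)
      \<le> c * emeasure lborel (cball (0 :: real ^ 'd) 3) / emeasure lborel (cball (0 :: real ^ 'd) 1)"
    by (rule divide_right_mono_ennreal)
  then show ?thesis
    unfolding uniform_ball_def ball_ratio_def
    by (subst nn_integral_uniform_measure) (auto simp: divide_ennreal_def ac_simps)
qed

section \<open>Half powers of the inverse\<close>

lemma ennreal_inverse_antimono: "a \<le> b \<Longrightarrow> inverse b \<le> inverse (a :: ennreal)"
  including ennreal.lifting by transfer (auto intro: ereal_inverse_antimono)

text \<open>Taken in \<^typ>\<open>ennreal\<close>, so that the inverse is infinite at \<open>0\<close>.\<close>

definition inv_sqrt :: "real \<Rightarrow> ennreal" where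
  "inv_sqrt u = inverse (ennreal (sqrt \<bar>u\<bar>))"

lemma measurable_inv_sqrt [measurable]: "inv_sqrt \<in> borel_measurable borel"
  unfolding inv_sqrt_def by measurable

text \<open>Also valid at 0: \<open>inv_sqrt\<close> of a real number is never 0, so no product of 0
  and infinity arises.\<close>

lemma inv_sqrt_mult: "inv_sqrt (u * v) = inv_sqrt u * inv_sqrt v"
  unfolding inv_sqrt_def
  by (simp add: abs_mult real_sqrt_mult ennreal_mult ennreal_inverse_mult)

text \<open>\<open>w\<close> dominates the geometric mean of \<open>\<bar>u\<bar>\<close> and
  \<open>\<bar>v\<bar>\<close>. Half powers are locally integrable on the line, which the full
  inverse is not.\<close>

lemma inverse_le_inv_sqrt:
  assumes "\<bar>u\<bar> \<le> w" "\<bar>v\<bar> \<le> w"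
  shows "inverse (ennreal w) \<le> inv_sqrt u * inv_sqrt v"
proof -
  have "sqrt \<bar>u * v\<bar> \<le> sqrt (w * w)"
    using assms by (intro real_sqrt_le_mono) (auto simp: abs_mult intro!: mult_mono)
  then have "sqrt \<bar>u * v\<bar> \<le> w"
    using assms by simp
  then have "inverse (ennreal w) \<le> inv_sqrt (u * v)"
    unfolding inv_sqrt_def by (intro ennreal_inverse_antimono ennreal_leI)
  then show ?thesis
    by (simp add: inv_sqrt_mult)
qed

text \<open>Where the argument exceeds 1 in absolute value the integrand is at most 1, and each side
  of the singularity contributes 2. This gives 1 + 2 + 2, uniformly in \<open>c\<close>.\<close>

lemma nn_integral_inv_sqrt_le_5: "(\<integral>\<^sup>+t. inv_sqrt (c + t) * indicator {0..1} t \<partial>lborel) \<le> 5"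
proof -
  have half: "(\<integral>\<^sup>+t. inv_sqrt t * indicator {0..1} t \<partial>lborel) = 2"
  proof -
    \<comment> \<open>The integrands differ at 0, where \<open>inv_sqrt\<close> is infinite but
      \<open>powr\<close> gives 0; a single point is null.\<close>
    have "AE t in lborel. inv_sqrt t * indicator {0..1} t = ennreal (t powr (-1/2)) * indicator {0..1} t"
      using AE_lborel_singleton[of 0]
    proof eventually_elim
      case (elim t)
      then show ?case
        by (auto simp: inv_sqrt_def indicator_def inverse_ennreal powr_minus powr_half_sqrt)
    qed
    then have "(\<integral>\<^sup>+t. inv_sqrt t * indicator {0..1} t \<partial>lborel)
        = (\<integral>\<^sup>+t. ennreal (t powr (-1/2)) * indicator {0..1} t \<partial>lborel)"
      by (rule nn_integral_cong_AE)
    also have "\<dots> = ennreal 2"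
      using nn_integral_has_integral_lebesgue'[OF _ has_integral_powr_from_0[of "-1/2" 1]] by simp
    finally show ?thesis by simp
  qed
  have half': "(\<integral>\<^sup>+t. inv_sqrt t * indicator {-1..0} t \<partial>lborel) = 2"
  proof -
    have "inv_sqrt (- t) * indicator {-1..0} (- t) = inv_sqrt t * indicator {0..1} t" for t
      by (auto simp: inv_sqrt_def indicator_def)
    then show ?thesis
      using half nn_integral_real_affine[of "\<lambda>t. inv_sqrt t * indicator {-1..0} t" "-1" 0] by simp
  qed
  have bound: "inv_sqrt u \<le> 1 + inv_sqrt u * indicator {-1..0} u + inv_sqrt u * indicator {0..1} u" for u
  proof (cases "\<bar>u\<bar> \<le> 1")
    case False
    then have "1 \<le> sqrt \<bar>u\<bar>" by simp
    then have "inv_sqrt u \<le> inverse (ennreal 1)"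
      unfolding inv_sqrt_def by (intro ennreal_inverse_antimono ennreal_leI)
    then show ?thesis
      by (simp add: add_increasing2)
  qed (auto simp: indicator_def intro: add_increasing add_increasing2)
  have "(\<integral>\<^sup>+t. inv_sqrt (c + t) * indicator {0..1} t \<partial>lborel)
      \<le> (\<integral>\<^sup>+t. indicator {0..1} t + inv_sqrt (c + t) * indicator {-1..0} (c + t)
             + inv_sqrt (c + t) * indicator {0..1} (c + t) \<partial>lborel)"
    using bound[of "c + _"] by (intro nn_integral_mono) (auto simp: indicator_def)
  also have "\<dots> = 1 + (\<integral>\<^sup>+t. inv_sqrt (c + t) * indicator {-1..0} (c + t) \<partial>lborel)
             + (\<integral>\<^sup>+t. inv_sqrt (c + t) * indicator {0..1} (c + t) \<partial>lborel)"
    by (simp add: nn_integral_add)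
  also have "\<dots> = 1 + 2 + 2"
    using half half'
      nn_integral_real_affine[of "\<lambda>t. inv_sqrt t * indicator {-1..0} t" 1 c]
      nn_integral_real_affine[of "\<lambda>t. inv_sqrt t * indicator {0..1} t" 1 c]
    by simp
  finally show ?thesis by simp
qed

text \<open>Factoring out the slope leaves a translate, for which the bound is uniform.\<close>

lemma nn_integral_inv_sqrt_affine_le:
  assumes "m \<noteq> 0"
  shows "(\<integral>\<^sup>+t. inv_sqrt (c + m * t) * indicator {0..1} t \<partial>lborel) \<le> 5 * inv_sqrt m"
proof -
  have "inv_sqrt (c + m * t) = inv_sqrt m * inv_sqrt (c / m + t)" for t
    using assms by (simp add: inv_sqrt_mult[symmetric] distrib_left)
  then have "(\<integral>\<^sup>+t. inv_sqrt (c + m * t) * indicator {0..1} t \<partial>lborel)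
      = inv_sqrt m * (\<integral>\<^sup>+t. inv_sqrt (c / m + t) * indicator {0..1} t \<partial>lborel)"
    by (simp add: nn_integral_cmult mult.assoc)
  also have "\<dots> \<le> inv_sqrt m * 5"
    by (intro mult_left_mono nn_integral_inv_sqrt_le_5) simp
  finally show ?thesis
    by (simp add: mult.commute)
qed

section \<open>Minors of the orientation matrix\<close>

text \<open>Homogeneous coordinates: the row that a point contributes to the orientation
  matrix.\<close>

definition affine_lift :: "real ^ 'd::finite \<Rightarrow> real ^ 'd option" where
  "affine_lift x = (\<chi> j. case j of Some i \<Rightarrow> x $ i | None \<Rightarrow> 1)"

lemma orientation_eq_sgn_det: "orientation x = sgn (det (\<chi> k. affine_lift (x k)))"
  by (simp add: orientation_def affine_lift_def)

lemma affine_lift_add_axis: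
  "affine_lift (z + t *\<^sub>R axis a 1) = affine_lift z + t *s axis (Some a) 1"
  by (auto simp: affine_lift_def vec_eq_iff axis_def split: option.split)

text \<open>Up to sign, the \<open>I\<close>-row minors of the orientation matrix that contain the column of ones (or \<open>0\<close>,
  if \<open>\<sigma>\<close> repeats a column): expressing them as full determinants avoids matrices of varying size.\<close>

definition minor :: "'d::finite option set \<Rightarrow> ('d option \<Rightarrow> 'd) \<Rightarrow> ('d option \<Rightarrow> real ^ 'd) \<Rightarrow> real" where
  "minor I \<sigma> x = det (\<chi> k. if k \<in> I then affine_lift (x k) else axis (Some (\<sigma> k)) 1)"

text \<open>The quantity \<open>W\<^sub>k\<close> of the overview, for the rows in \<open>I\<close>.
  There are finitely many column choices, so the maximum is attained.\<close>

definition max_minor :: "'d::finite option set \<Rightarrow> ('d option \<Rightarrow> real ^ 'd) \<Rightarrow> real" where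
  "max_minor I x = Max (range (\<lambda>\<sigma>. \<bar>minor I \<sigma> x\<bar>))"

lemma minor_le_max_minor: "\<bar>minor I \<sigma> x\<bar> \<le> max_minor I x"
  unfolding max_minor_def by (intro Max_ge) auto

lemma max_minor_attained:
  obtains \<sigma> where "max_minor I x = \<bar>minor I \<sigma> x\<bar>"
proof -
  have "max_minor I x \<in> range (\<lambda>\<sigma>. \<bar>minor I \<sigma> x\<bar>)"
    unfolding max_minor_def by (intro Max_in) auto
  then show ?thesis using that by auto
qed

text \<open>The determinant is linear in row \<open>i\<close>, and a shift along an axis adds a
  multiple of a unit vector to that row, as the column of ones is unaffected. The slope is therefore
  a minor with one filled row fewer.\<close>

lemma minor_insert_add_axis:
  assumes "i \<notin> I"
  shows "minor (insert i I) \<sigma> (x(i := z + t *\<^sub>R axis a 1))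
    = minor (insert i I) \<sigma> (x(i := z)) + t * minor I (\<sigma>(i := a)) x"
proof -
  define c where "c k = (if k \<in> I then affine_lift (x k) else axis (Some (\<sigma> k)) 1)" for k
  have "minor (insert i I) \<sigma> (x(i := y)) = det (\<chi> k. if k = i then affine_lift y else c k)" for y
    unfolding minor_def c_def by (rule arg_cong[where f = det]) (auto simp: vec_eq_iff)
  moreover have "minor I (\<sigma>(i := a)) x = det (\<chi> k. if k = i then axis (Some a) 1 else c k)"
    using assms unfolding minor_def c_def by (intro arg_cong[where f = det]) (auto simp: vec_eq_iff)
  ultimately show ?thesis
    using det_row_add[of i "\<lambda>_. affine_lift z" "\<lambda>_. t *s axis (Some a) 1" c]
      det_row_mul[of i t "\<lambda>_. axis (Some a) 1" c]
    by (simp add: affine_lift_add_axis cong: if_cong)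
qed

text \<open>Two unfilled rows then carry the same unit vector.\<close>

lemma minor_eq_0:
  assumes "i \<notin> I" "j \<notin> I" "i \<noteq> j" "\<sigma> i = \<sigma> j"
  shows "minor I \<sigma> x = 0"
  unfolding minor_def
  by (rule det_identical_rows[OF assms(3)]) (use assms in \<open>auto simp: row_def vec_eq_iff\<close>)

text \<open>Exchanging the unit vectors of two unfilled rows is a row transposition.\<close>

lemma minor_swap:
  assumes "i \<notin> I" "j \<notin> I" "i \<noteq> j"
  shows "minor I (\<sigma>(i := \<sigma> j, j := \<sigma> i)) x = - minor I \<sigma> x"
proof -
  define A :: "real ^ 'a option ^ 'a option"
    where "A = (\<chi> k. if k \<in> I then affine_lift (x k) else axis (Some (\<sigma> k)) 1)"
  have "minor I (\<sigma>(i := \<sigma> j, j := \<sigma> i)) x = det (\<chi> k. A $ Transposition.transpose i j k)"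
    unfolding minor_def A_def using assms
    by (intro arg_cong[where f = det]) (auto simp: vec_eq_iff Transposition.transpose_def)
  also have "\<dots> = - det A"
    using assms by (subst det_permute_rows) (auto simp: permutes_swap_id sign_swap_id)
  finally show ?thesis
    by (simp add: minor_def A_def)
qed

text \<open>With \<open>the\<close> as column choice, each row \<open>Some a\<close> is its own unit
  vector, so only row \<open>None\<close> differs from the identity matrix. Expanding that row
  leaves its entry in the column of ones. This starts the induction on the revealed points.\<close>

lemma minor_singleton_None: "minor {None} the x = 1"
proof -
  define A :: "real ^ 'a option \<Rightarrow> real ^ 'a option ^ 'a option"
    where "A v = (\<chi> k. if k = None then v else axis k 1)" for v
  have "minor {None} the x = det (A (affine_lift (x None)))"
    unfolding minor_def A_def by (intro arg_cong[where f = det]) (auto simp: vec_eq_iff)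
  also have "affine_lift (x None) = (\<Sum>j\<in>UNIV. affine_lift (x None) $ j *s axis j 1)"
    by (simp add: basis_expansion)
  also have "det (A \<dots>) = (\<Sum>j\<in>UNIV. affine_lift (x None) $ j * det (A (axis j 1)))"
    unfolding A_def by (subst det_linear_row_sum) (auto simp: det_row_mul)
  also have "\<dots> = affine_lift (x None) $ None * det (A (axis None 1))"
  proof (subst sum.remove[of _ None])
    \<comment> \<open>Row \<open>None\<close> would repeat the unit vector in row
      \<open>j\<close>.\<close>
    have "det (A (axis j 1)) = 0" if "j \<noteq> None" for j
      by (rule det_identical_rows[OF that]) (use that in \<open>auto simp: row_def A_def vec_eq_iff\<close>)
    then show "affine_lift (x None) $ None * det (A (axis None 1))
        + (\<Sum>j\<in>UNIV - {None}. affine_lift (x None) $ j * det (A (axis j 1)))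
      = affine_lift (x None) $ None * det (A (axis None 1))"
      by simp
  qed auto
  also have "A (axis None 1) = mat 1"
    by (auto simp: A_def vec_eq_iff mat_def axis_def)
  finally show ?thesis
    by (simp add: affine_lift_def)
qed

lemma max_minor_singleton_None: "1 \<le> max_minor {None} x"
  using minor_le_max_minor[of "{None}" the x] by (simp add: minor_singleton_None)

lemma measurable_affine_lift [measurable]:
  "f \<in> borel_measurable M \<Longrightarrow> (\<lambda>w. affine_lift (f w) $ j) \<in> borel_measurable M"
  by (cases j) (auto simp: affine_lift_def intro: measurable_compose[OF _ borel_measurable_nth])

text \<open>The determinant is a polynomial in its entries, and only the rows in \<open>I\<close>
  depend on \<open>x\<close>. Hence minors are measurable already on the product over
  \<open>I\<close>.\<close>

lemma measurable_minor:
  assumes "\<And>k. k \<in> I \<Longrightarrow> (\<lambda>w. x w k) \<in> borel_measurable M"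
  shows "(\<lambda>w. minor I \<sigma> (x w)) \<in> borel_measurable M"
proof -
  have "(\<lambda>w. (if k \<in> I then affine_lift (x w k) else axis (Some (\<sigma> k)) 1) $ j) \<in> borel_measurable M" for k j
    using assms by (cases "k \<in> I") auto
  then show ?thesis
    unfolding minor_def det_def by simp
qed

lemma measurable_max_minor:
  assumes "\<And>k. k \<in> I \<Longrightarrow> (\<lambda>w. x w k) \<in> borel_measurable M"
  shows "(\<lambda>w. max_minor I (x w)) \<in> borel_measurable M"
  unfolding max_minor_def
  by (intro borel_measurable_Max borel_measurable_abs measurable_minor assms) auto

section \<open>Revealing one more point\<close>

text \<open>For the degenerate case of the estimates below: if the preceding maximal minor is 0, the
  right-hand side is a nonzero factor times infinity and the bound is trivial.\<close>

lemma ball_ratio_pos: "ball_ratio TYPE('d::finite) > 0"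
  using emeasure_cball_pos[of 3, where 'a = "real ^ 'd"] emeasure_lborel_cball_finite[of "0::real^'d" 1]
  by (auto simp: ball_ratio_def zero_less_iff_neq_zero)

text \<open>Recombines the two half powers, coming from slopes \<open>m\<close> and
  \<open>- m\<close>, into a full inverse.\<close>

lemma inv_sqrt_mult_minus: "inv_sqrt m * inv_sqrt (- m) = inverse (ennreal \<bar>m\<bar>)"
proof -
  have "inverse (ennreal \<bar>m\<bar>) = inv_sqrt (m * - m)"
    by (simp add: inv_sqrt_def abs_mult)
  then show ?thesis
    by (simp only: inv_sqrt_mult)
qed

text \<open>Swapping the unit vectors in the unfilled rows \<open>i\<close> and \<open>j\<close> of the maximal minor gives a second
  minor of the same size. After filling row \<open>i\<close>, each of the two depends on its own coordinate of \<open>z\<close>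
  with slope \<open>\<plusminus> m\<close> and not on the coordinate of the other, so the double average factorizes.\<close>

lemma nn_integral_inverse_max_minor_le:
  fixes x :: "'d::finite option \<Rightarrow> real ^ 'd"
  assumes i: "i \<notin> I" and j: "j \<notin> I" and ij: "i \<noteq> j"
  shows "(\<integral>\<^sup>+z. inverse (ennreal (max_minor (insert i I) (x(i := z)))) \<partial>uniform_ball)
    \<le> ball_ratio TYPE('d) * 25 * inverse (ennreal (max_minor I x))"
proof -
  obtain \<sigma> where \<sigma>: "max_minor I x = \<bar>minor I \<sigma> x\<bar>"
    by (rule max_minor_attained)
  define m where "m = minor I \<sigma> x"
  define \<sigma>' where "\<sigma>' = \<sigma>(i := \<sigma> j, j := \<sigma> i)"
  define M where "M \<tau> z = minor (insert i I) \<tau> (x(i := z))" for \<tau> z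
  show ?thesis
  proof (cases "m = 0")
    case True
    then show ?thesis
      using ball_ratio_pos[where 'd = 'd] by (simp add: \<sigma> m_def ennreal_mult_eq_top_iff)
  next
    case False
    have meas: "(\<lambda>z. inverse (ennreal (max_minor (insert i I) (x(i := z))))) \<in> borel_measurable borel"
    proof -
      have "(\<lambda>z. (x(i := z)) k) \<in> borel_measurable borel" for k
        by (cases "k = i") auto
      then have [measurable]: "(\<lambda>z. max_minor (insert i I) (x(i := z))) \<in> borel_measurable borel"
        by (intro measurable_max_minor)
      show ?thesis by measurable
    qed
    have M\<sigma>: "M \<sigma> (z + s *\<^sub>R axis (\<sigma> j) 1 + t *\<^sub>R axis (\<sigma> i) 1) = M \<sigma> z + m * t" for z s t
    proof -
      \<comment> \<open>The slope along \<open>axis (\<sigma> j) 1\<close> vanishes because rows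
        \<open>i\<close> and \<open>j\<close> would both carry column
        \<open>\<sigma> j\<close>.\<close>
      have "minor I (\<sigma>(i := \<sigma> j)) x = 0"
        using i j ij by (intro minor_eq_0[of i I j]) auto
      then show ?thesis
        using i by (simp add: M_def minor_insert_add_axis m_def)
    qed
    have M\<sigma>': "M \<sigma>' (z + s *\<^sub>R axis (\<sigma> j) 1 + t *\<^sub>R axis (\<sigma> i) 1) = M \<sigma>' z + (- m) * s" for z s t
    proof -
      \<comment> \<open>Here column \<open>\<sigma> i\<close> is repeated, since
        \<open>\<sigma>'\<close> already has it in row \<open>j\<close>.\<close>
      have "minor I (\<sigma>'(i := \<sigma> i)) x = 0"
        using i j ij by (intro minor_eq_0[of i I j]) (auto simp: \<sigma>'_def)
      moreover have "\<sigma>'(i := \<sigma> j) = \<sigma>'"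
        using ij by (auto simp: \<sigma>'_def)
      moreover have "minor I \<sigma>' x = - m"
        unfolding \<sigma>'_def m_def by (rule minor_swap[OF i j ij])
      ultimately show ?thesis
        using i by (simp add: M_def minor_insert_add_axis)
    qed
    have "(\<integral>\<^sup>+z. inverse (ennreal (max_minor (insert i I) (x(i := z)))) \<partial>uniform_ball)
      \<le> ball_ratio TYPE('d) * ((5 * inv_sqrt m) * (5 * inv_sqrt (- m)))"
    proof (rule nn_integral_uniform_ball_le_average[OF meas, of "axis (\<sigma> i) 1" "axis (\<sigma> j) 1"])
      fix z :: "real ^ 'd"
      let ?F = "\<lambda>s t. inverse (ennreal (max_minor (insert i I)
        (x(i := z + s *\<^sub>R axis (\<sigma> j) 1 + t *\<^sub>R axis (\<sigma> i) 1))))"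
      have F: "?F s t \<le> inv_sqrt (M \<sigma> z + m * t) * inv_sqrt (M \<sigma>' z + (- m) * s)" for s t
        unfolding M\<sigma>[symmetric, of z t s] M\<sigma>'[symmetric, of z s t]
        unfolding M_def by (intro inverse_le_inv_sqrt minor_le_max_minor)
      have "(\<integral>\<^sup>+s. (\<integral>\<^sup>+t. ?F s t * indicator {0..1} t \<partial>lborel) * indicator {0..1} s \<partial>lborel)
        \<le> (\<integral>\<^sup>+s. (\<integral>\<^sup>+t. inv_sqrt (M \<sigma> z + m * t) * inv_sqrt (M \<sigma>' z + (- m) * s)
              * indicator {0..1} t \<partial>lborel) * indicator {0..1} s \<partial>lborel)"
        by (intro nn_integral_mono mult_right_mono F) auto
      also have "\<dots> = (\<integral>\<^sup>+s. (\<integral>\<^sup>+t. inv_sqrt (M \<sigma> z + m * t) * indicator {0..1} t \<partial>lborel) *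
              (inv_sqrt (M \<sigma>' z + (- m) * s) * indicator {0..1} s) \<partial>lborel)"
        by (intro nn_integral_cong, subst mult.assoc[symmetric], subst nn_integral_multc[symmetric])
           (auto intro!: arg_cong2[where f = "(*)"] nn_integral_cong simp: ac_simps)
      also have "\<dots> = (\<integral>\<^sup>+t. inv_sqrt (M \<sigma> z + m * t) * indicator {0..1} t \<partial>lborel) *
              (\<integral>\<^sup>+s. inv_sqrt (M \<sigma>' z + (- m) * s) * indicator {0..1} s \<partial>lborel)"
        by (intro nn_integral_cmult) measurable
      also have "\<dots> \<le> (5 * inv_sqrt m) * (5 * inv_sqrt (- m))"
        using False by (intro mult_mono nn_integral_inv_sqrt_affine_le) auto
      finally show "(\<integral>\<^sup>+s. (\<integral>\<^sup>+t. ?F s t * indicator {0..1} t \<partial>lborel) * indicator {0..1} s \<partial>lborel)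
        \<le> (5 * inv_sqrt m) * (5 * inv_sqrt (- m))" .
    qed auto
    also have "(5 * inv_sqrt m) * (5 * inv_sqrt (- m)) = 25 * (inv_sqrt m * inv_sqrt (- m))"
      by (simp add: ac_simps flip: mult.assoc)
    finally show ?thesis
      by (simp only: \<sigma> m_def inv_sqrt_mult_minus mult.assoc)
  qed
qed

text \<open>The largest minor \<open>m\<close> of the rows \<open>I\<close> is the slope, along one
  axis, of a minor of the rows \<open>insert i I\<close>. On a line in that direction the latter is
  at most \<open>\<delta>\<close> in absolute value only on an interval of length
  \<open>2 * \<delta> / \<bar>m\<bar>\<close>.\<close>

lemma nn_integral_small_max_minor_le:
  fixes x :: "'d::finite option \<Rightarrow> real ^ 'd"
  assumes i: "i \<notin> I" and \<delta>: "\<delta> > 0"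
  shows "(\<integral>\<^sup>+z. indicator {..\<delta>} (max_minor (insert i I) (x(i := z))) \<partial>uniform_ball)
    \<le> ball_ratio TYPE('d) * ennreal (2 * \<delta>) * inverse (ennreal (max_minor I x))"
proof -
  obtain \<sigma> where \<sigma>: "max_minor I x = \<bar>minor I \<sigma> x\<bar>"
    by (rule max_minor_attained)
  define m where "m = minor I \<sigma> x"
  show ?thesis
  proof (cases "m = 0")
    case True
    then show ?thesis
      using ball_ratio_pos[where 'd = 'd] \<delta> by (simp add: \<sigma> m_def ennreal_mult_eq_top_iff)
  next
    case False
    have meas: "(\<lambda>z. indicator {..\<delta>} (max_minor (insert i I) (x(i := z))) :: ennreal) \<in> borel_measurable borel"
    proof -
      have "(\<lambda>z. (x(i := z)) k) \<in> borel_measurable borel" for k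
        by (cases "k = i") auto
      then have [measurable]: "(\<lambda>z. max_minor (insert i I) (x(i := z))) \<in> borel_measurable borel"
        by (intro measurable_max_minor)
      show ?thesis by measurable
    qed
    have "(\<integral>\<^sup>+z. indicator {..\<delta>} (max_minor (insert i I) (x(i := z))) \<partial>uniform_ball)
      \<le> ball_ratio TYPE('d) * ennreal (2 * \<delta> / \<bar>m\<bar>)"
    \<comment> \<open>A single direction suffices, so the second shift is along 0.\<close>
    proof (rule nn_integral_uniform_ball_le_average[OF meas, of "axis (\<sigma> i) 1" 0])
      fix z :: "real ^ 'd"
      define u where "u = minor (insert i I) \<sigma> (x(i := z))"
      \<comment> \<open>The set of all \<open>t\<close> with
        \<open>\<bar>u + m * t\<bar> \<le> \<delta>\<close>.\<close>
      let ?A = "{- u / m - \<delta> / \<bar>m\<bar> .. - u / m + \<delta> / \<bar>m\<bar>}"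
      have F: "indicator {..\<delta>} (max_minor (insert i I) (x(i := z + s *\<^sub>R 0 + t *\<^sub>R axis (\<sigma> i) 1)))
          * indicator {0..1} t \<le> (indicator ?A t :: ennreal)" for s t :: real
      proof (cases "max_minor (insert i I) (x(i := z + s *\<^sub>R 0 + t *\<^sub>R axis (\<sigma> i) 1)) \<le> \<delta>")
        case True
        have "\<bar>u + m * t\<bar> = \<bar>minor (insert i I) \<sigma> (x(i := z + s *\<^sub>R 0 + t *\<^sub>R axis (\<sigma> i) 1))\<bar>"
          using i by (simp add: u_def m_def minor_insert_add_axis mult.commute)
        also have "\<dots> \<le> max_minor (insert i I) (x(i := z + s *\<^sub>R 0 + t *\<^sub>R axis (\<sigma> i) 1))"
          by (rule minor_le_max_minor)
        finally have "\<bar>u + m * t\<bar> \<le> \<delta>"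
          using True by linarith
        moreover have "\<bar>u + m * t\<bar> = \<bar>m\<bar> * \<bar>u / m + t\<bar>"
          using False by (simp add: distrib_left flip: abs_mult)
        ultimately have "\<bar>u / m + t\<bar> \<le> \<delta> / \<bar>m\<bar>"
          using False by (simp add: pos_le_divide_eq mult.commute)
        then have "t \<in> ?A"
          by (auto simp: abs_le_iff)
        then show ?thesis
          by (auto simp: indicator_def)
      qed auto
      have "(\<integral>\<^sup>+t. indicator {..\<delta>} (max_minor (insert i I) (x(i := z + s *\<^sub>R 0 + t *\<^sub>R axis (\<sigma> i) 1)))
          * indicator {0..1} t \<partial>lborel) \<le> ennreal (2 * \<delta> / \<bar>m\<bar>)" for s :: real
      proof -
        have "(\<integral>\<^sup>+t. indicator {..\<delta>} (max_minor (insert i I) (x(i := z + s *\<^sub>R 0 + t *\<^sub>R axis (\<sigma> i) 1)))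
            * indicator {0..1} t \<partial>lborel) \<le> (\<integral>\<^sup>+t. indicator ?A t \<partial>lborel)"
          by (intro nn_integral_mono F)
        also have "\<dots> = ennreal (2 * \<delta> / \<bar>m\<bar>)"
          using \<delta> by simp
        finally show ?thesis .
      qed
      then have "(\<integral>\<^sup>+s. (\<integral>\<^sup>+t. indicator {..\<delta>} (max_minor (insert i I)
          (x(i := z + s *\<^sub>R 0 + t *\<^sub>R axis (\<sigma> i) 1))) * indicator {0..1} t \<partial>lborel)
          * indicator {0..1} s \<partial>lborel) \<le> (\<integral>\<^sup>+s. ennreal (2 * \<delta> / \<bar>m\<bar>) * indicator {0..1::real} s \<partial>lborel)"
        by (intro nn_integral_mono mult_right_mono) auto
      also have "\<dots> = ennreal (2 * \<delta> / \<bar>m\<bar>)"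
        by (simp add: nn_integral_cmult)
      finally show "(\<integral>\<^sup>+s. (\<integral>\<^sup>+t. indicator {..\<delta>} (max_minor (insert i I)
          (x(i := z + s *\<^sub>R 0 + t *\<^sub>R axis (\<sigma> i) 1))) * indicator {0..1} t \<partial>lborel)
          * indicator {0..1} s \<partial>lborel) \<le> ennreal (2 * \<delta> / \<bar>m\<bar>)" .
    qed auto
    also have "ennreal (2 * \<delta> / \<bar>m\<bar>) = ennreal (2 * \<delta>) * inverse (ennreal \<bar>m\<bar>)"
      using \<delta> False by (simp add: divide_inverse ennreal_mult' inverse_ennreal)
    finally show ?thesis
      by (simp only: \<sigma> m_def mult.assoc)
  qed
qed

section \<open>Small-ball estimate for the determinant\<close>

lemma product_sigma_finite_uniform_ball:
  "product_sigma_finite (\<lambda>_. uniform_ball :: (real ^ 'd::finite) measure)"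
  by (simp add: product_sigma_finite_def prob_space_imp_sigma_finite prob_space_uniform_ball)

lemma measurable_max_minor_PiM:
  "max_minor I \<in> borel_measurable (PiM I (\<lambda>_. uniform_ball :: (real ^ 'd::finite) measure))"
  using measurable_max_minor[of I "\<lambda>w. w" "PiM I (\<lambda>_. uniform_ball :: (real ^ 'd) measure)"]
  by simp

text \<open>Induction on the revealed rows: row \<open>None\<close> alone has a maximal minor of at
  least 1, and each further point costs one factor. Since the filled rows never exhaust
  \<open>UNIV\<close>, a second unfilled row is available at every step, as the one-point estimate
  requires.\<close>

lemma nn_integral_inverse_max_minor_PiM_le:
  fixes J :: "'d::finite option set"
  assumes "finite J" "None \<notin> J" "insert None J \<noteq> UNIV"
  shows "(\<integral>\<^sup>+x. inverse (ennreal (max_minor (insert None J) x)) \<partial>PiM (insert None J) (\<lambda>_. uniform_ball))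
    \<le> (ball_ratio TYPE('d) * 25) ^ card J"
  using assms
proof (induction J rule: finite_induct)
  case empty
  interpret prob_space "PiM {None :: 'd option} (\<lambda>_. uniform_ball :: (real ^ 'd) measure)"
    by (intro prob_space_PiM prob_space_uniform_ball)
  have "(\<integral>\<^sup>+x. inverse (ennreal (max_minor {None} x)) \<partial>PiM {None :: 'd option} (\<lambda>_. uniform_ball))
      \<le> (\<integral>\<^sup>+x. 1 \<partial>PiM {None :: 'd option} (\<lambda>_. uniform_ball :: (real ^ 'd) measure))"
  proof (rule nn_integral_mono)
    fix x :: "'d option \<Rightarrow> real ^ 'd"
    have "inverse (ennreal (max_minor {None} x)) \<le> inverse (ennreal 1)"
      by (intro ennreal_inverse_antimono ennreal_leI max_minor_singleton_None)
    then show "inverse (ennreal (max_minor {None} x)) \<le> 1" by simp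
  qed
  also have "\<dots> = 1"
    using emeasure_space_1 by simp
  finally show ?case by simp
next
  case (insert i J)
  interpret product_sigma_finite "\<lambda>_ :: 'd option. uniform_ball :: (real ^ 'd) measure"
    by (rule product_sigma_finite_uniform_ball)
  obtain j where j: "j \<notin> insert None (insert i J)"
    using insert.prems by auto
  let ?K = "ball_ratio TYPE('d) * 25"
  let ?I = "insert None J"
  have i: "i \<notin> ?I"
    using insert by auto
  have [measurable]: "max_minor ?I \<in> borel_measurable (PiM ?I (\<lambda>_. uniform_ball))"
    "max_minor (insert i ?I) \<in> borel_measurable (PiM (insert i ?I) (\<lambda>_. uniform_ball))"
    by (rule measurable_max_minor_PiM)+
  have "(\<integral>\<^sup>+x. inverse (ennreal (max_minor (insert i ?I) x)) \<partial>PiM (insert i ?I) (\<lambda>_. uniform_ball))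
     = (\<integral>\<^sup>+x. (\<integral>\<^sup>+z. inverse (ennreal (max_minor (insert i ?I) (x(i := z)))) \<partial>uniform_ball)
         \<partial>PiM ?I (\<lambda>_. uniform_ball))"
    using i insert.hyps by (intro product_nn_integral_insert) auto
  also have "\<dots> \<le> (\<integral>\<^sup>+x. ?K * inverse (ennreal (max_minor ?I x)) \<partial>PiM ?I (\<lambda>_. uniform_ball))"
    using i j by (intro nn_integral_mono nn_integral_inverse_max_minor_le[of _ _ j]) auto
  also have "\<dots> = ?K * (\<integral>\<^sup>+x. inverse (ennreal (max_minor ?I x)) \<partial>PiM ?I (\<lambda>_. uniform_ball))"
    by (intro nn_integral_cmult) measurable
  also have "\<dots> \<le> ?K * ?K ^ card J"
    using insert.prems j by (intro mult_left_mono insert.IH) auto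
  finally show ?case
    using insert.hyps by (simp add: insert_commute)
qed

lemma minor_UNIV: "minor UNIV \<sigma> x = det (\<chi> k. affine_lift (x k))"
  by (simp add: minor_def)

lemma max_minor_UNIV: "max_minor UNIV x = \<bar>det (\<chi> k. affine_lift (x k))\<bar>"
  by (metis max_minor_attained minor_UNIV)

text \<open>Integrating out the last row gives a multiple of \<open>\<delta>\<close> times the
  inverse maximal minor of the other rows, whose integral is finite.\<close>

lemma emeasure_small_det_le:
  "\<exists>C\<ge>0. \<forall>\<delta>>0. emeasure (PiM UNIV (\<lambda>_ :: 'd::finite option. uniform_ball))
     {x. \<bar>det (\<chi> k. affine_lift (x k))\<bar> \<le> \<delta>} \<le> ennreal (C * \<delta>)"
proof -
  interpret product_sigma_finite "\<lambda>_ :: 'd option. uniform_ball :: (real ^ 'd) measure"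
    by (rule product_sigma_finite_uniform_ball)
  \<comment> \<open>An arbitrary row other than \<open>None\<close>, to be revealed last.\<close>
  define i :: "'d option" where "i = Some undefined"
  define J where "J = UNIV - {None, i}"
  let ?I = "insert None J"
  let ?K = "ball_ratio TYPE('d) * 25"
  have I: "insert i ?I = UNIV" "i \<notin> ?I"
    by (auto simp: J_def i_def)
  \<comment> \<open>The factor \<open>ball_ratio * 2\<close> comes from row \<open>i\<close>, the
    power from the rows in \<open>J\<close>.\<close>
  define K where "K = ball_ratio TYPE('d) * 2 * ?K ^ card J"
  have "K < \<infinity>"
    using ball_ratio_finite[where 'd = 'd]
    by (simp add: K_def ennreal_mult_less_top power_less_top_ennreal)
  then obtain C where C: "C \<ge> 0" "K = ennreal C"
    by (cases K) auto
  have "emeasure (PiM UNIV (\<lambda>_ :: 'd option. uniform_ball))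
     {x. \<bar>det (\<chi> k. affine_lift (x k))\<bar> \<le> \<delta>} \<le> ennreal (C * \<delta>)" if \<delta>: "\<delta> > 0" for \<delta>
  proof -
    have [measurable]: "max_minor ?I \<in> borel_measurable (PiM ?I (\<lambda>_. uniform_ball))"
      "max_minor UNIV \<in> borel_measurable (PiM UNIV (\<lambda>_ :: 'd option. uniform_ball))"
      by (rule measurable_max_minor_PiM)+
    have ind: "(\<lambda>x. indicator {..\<delta>} (max_minor UNIV x)) \<in>
        borel_measurable (PiM UNIV (\<lambda>_ :: 'd option. uniform_ball))"
      by measurable
    have sp: "space (PiM UNIV (\<lambda>_ :: 'd option. uniform_ball :: (real ^ 'd) measure)) = UNIV"
      by (simp add: space_PiM)
    have "{x \<in> space (PiM UNIV (\<lambda>_ :: 'd option. uniform_ball)). max_minor UNIV x \<le> \<delta>}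
        \<in> sets (PiM UNIV (\<lambda>_ :: 'd option. uniform_ball))"
      by measurable
    then have "emeasure (PiM UNIV (\<lambda>_ :: 'd option. uniform_ball))
        {x. \<bar>det (\<chi> k. affine_lift (x k))\<bar> \<le> \<delta>}
      = (\<integral>\<^sup>+x. indicator {x. max_minor UNIV x \<le> \<delta>} x \<partial>PiM UNIV (\<lambda>_ :: 'd option. uniform_ball))"
      by (simp add: sp max_minor_UNIV)
    also have "\<dots> = (\<integral>\<^sup>+x. indicator {..\<delta>} (max_minor (insert i ?I) x)
        \<partial>PiM (insert i ?I) (\<lambda>_ :: 'd option. uniform_ball))"
      unfolding I by (intro nn_integral_cong) (auto simp: indicator_def)
    also have "\<dots> = (\<integral>\<^sup>+x. (\<integral>\<^sup>+z. indicator {..\<delta>} (max_minor (insert i ?I) (x(i := z))) \<partial>uniform_ball)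
        \<partial>PiM ?I (\<lambda>_. uniform_ball))"
      using I ind by (intro product_nn_integral_insert) auto
    also have "\<dots> \<le> (\<integral>\<^sup>+x. ball_ratio TYPE('d) * ennreal (2 * \<delta>) * inverse (ennreal (max_minor ?I x))
        \<partial>PiM ?I (\<lambda>_. uniform_ball))"
      using I \<delta> by (intro nn_integral_mono nn_integral_small_max_minor_le) auto
    also have "\<dots> = ball_ratio TYPE('d) * ennreal (2 * \<delta>) *
        (\<integral>\<^sup>+x. inverse (ennreal (max_minor ?I x)) \<partial>PiM ?I (\<lambda>_. uniform_ball))"
      by (intro nn_integral_cmult) measurable
    also have "\<dots> \<le> ball_ratio TYPE('d) * ennreal (2 * \<delta>) * ?K ^ card J"
      using I by (intro mult_left_mono nn_integral_inverse_max_minor_PiM_le) (auto simp: J_def)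
    also have "\<dots> = K * ennreal \<delta>"
      using \<delta> by (simp add: K_def ennreal_mult ac_simps)
    also have "\<dots> = ennreal (C * \<delta>)"
      using C \<delta> by (simp add: ennreal_mult)
    finally show ?thesis .
  qed
  with C show ?thesis by blast
qed

section \<open>Effect of rounding on the determinant\<close>

text \<open>By the Leibniz formula it suffices to compare products of entries. After division by
  \<open>R\<close> all factors have modulus at most 1, and then the products differ by at most the
  sum of the differences of the factors.\<close>

lemma abs_det_diff_le:
  fixes A B :: "real ^ 'n::finite ^ 'n"
  assumes R: "R > 0" and A: "\<And>i j. \<bar>A $ i $ j\<bar> \<le> R" and B: "\<And>i j. \<bar>B $ i $ j\<bar> \<le> R"
    and AB: "\<And>i j. \<bar>A $ i $ j - B $ i $ j\<bar> \<le> \<eta>"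
  shows "\<bar>det A - det B\<bar> \<le> real (card {p. p permutes (UNIV :: 'n set)}) *
    (R ^ CARD('n) * (real CARD('n) * (\<eta> / R)))"
proof -
  let ?P = "{p. p permutes (UNIV :: 'n set)}"
  have "\<bar>of_int (sign p) * (\<Prod>i\<in>UNIV. A $ i $ p i) - of_int (sign p) * (\<Prod>i\<in>UNIV. B $ i $ p i)\<bar>
      \<le> R ^ CARD('n) * (real CARD('n) * (\<eta> / R))" for p
  proof -
    have scale: "(\<Prod>i\<in>UNIV. D $ i $ p i) = R ^ CARD('n) * (\<Prod>i\<in>UNIV. D $ i $ p i / R)"
      for D :: "real ^ 'n ^ 'n"
      using R by (simp add: prod_dividef)
    have "\<bar>(\<Prod>i\<in>UNIV. A $ i $ p i / R) - (\<Prod>i\<in>UNIV. B $ i $ p i / R)\<bar>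
        \<le> (\<Sum>i\<in>UNIV. \<bar>A $ i $ p i / R - B $ i $ p i / R\<bar>)"
      using norm_prod_diff[of UNIV "\<lambda>i. A $ i $ p i / R" "\<lambda>i. B $ i $ p i / R"] A B R by simp
    also have "\<dots> \<le> (\<Sum>i\<in>(UNIV :: 'n set). \<eta> / R)"
      using AB R by (intro sum_mono) (simp add: divide_right_mono flip: diff_divide_distrib)
    finally have "\<bar>(\<Prod>i\<in>UNIV. A $ i $ p i / R) - (\<Prod>i\<in>UNIV. B $ i $ p i / R)\<bar> \<le> real CARD('n) * (\<eta> / R)"
      by simp
    then have "R ^ CARD('n) * \<bar>(\<Prod>i\<in>UNIV. A $ i $ p i / R) - (\<Prod>i\<in>UNIV. B $ i $ p i / R)\<bar>
        \<le> R ^ CARD('n) * (real CARD('n) * (\<eta> / R))"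
      using R by (intro mult_left_mono) auto
    moreover have "\<bar>of_int (sign p) * (R ^ CARD('n) * u) - of_int (sign p) * (R ^ CARD('n) * v)\<bar>
        = R ^ CARD('n) * \<bar>u - v\<bar>" for u v :: real
    proof -
      have "\<bar>of_int (sign p) * (R ^ CARD('n) * u) - of_int (sign p) * (R ^ CARD('n) * v)\<bar>
          = \<bar>R ^ CARD('n) * u - R ^ CARD('n) * v\<bar>"
        by (cases p rule: sign_cases) (auto simp: abs_minus_commute)
      also have "\<dots> = R ^ CARD('n) * \<bar>u - v\<bar>"
        using R by (simp add: abs_mult flip: right_diff_distrib)
      finally show ?thesis .
    qed
    ultimately show ?thesis
      unfolding scale[of A] scale[of B] by simp
  qed
  then have "(\<Sum>p\<in>?P. \<bar>of_int (sign p) * (\<Prod>i\<in>UNIV. A $ i $ p i) - of_int (sign p) * (\<Prod>i\<in>UNIV. B $ i $ p i)\<bar>)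
      \<le> (\<Sum>p\<in>?P. R ^ CARD('n) * (real CARD('n) * (\<eta> / R)))"
    by (intro sum_mono)
  moreover have "\<bar>det A - det B\<bar> \<le>
     (\<Sum>p\<in>?P. \<bar>of_int (sign p) * (\<Prod>i\<in>UNIV. A $ i $ p i) - of_int (sign p) * (\<Prod>i\<in>UNIV. B $ i $ p i)\<bar>)"
    unfolding det_def sum_subtractf[symmetric] by (rule sum_abs)
  ultimately show ?thesis
    by simp
qed

lemma rounds_to_iff:
  "rounds_to h x y \<longleftrightarrow> y \<in> grid h \<and> (\<forall>g\<in>grid h. dist x y \<le> dist x g)"
  by (auto simp: rounds_to_def is_arg_min_def not_less)

text \<open>Taking floors coordinatewise gives a grid point within \<open>h\<close> in each
  coordinate, hence within \<open>CARD('d) * h\<close> in Euclidean distance; a nearest grid point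
  is no farther away.\<close>

lemma rounds_to_component_le:
  fixes x :: "real ^ 'd::finite"
  assumes h: "h > 0" and xy: "rounds_to h x y"
  shows "\<bar>x $ j - y $ j\<bar> \<le> real CARD('d) * h"
proof -
  define g :: "real ^ 'd" where "g = (\<chi> j. h * of_int \<lfloor>x $ j / h\<rfloor>)"
  have g: "\<bar>x $ j - g $ j\<bar> \<le> h" for j
  proof -
    have "x $ j - g $ j = h * frac (x $ j / h)"
      using h by (simp add: g_def frac_def right_diff_distrib)
    then show ?thesis
      using h frac_lt_1[of "x $ j / h"] by (simp add: abs_mult mult_left_le frac_ge_0 less_imp_le)
  qed
  have "\<bar>x $ j - y $ j\<bar> \<le> dist x y"
    using component_le_norm_cart[of "x - y" j] by (simp add: dist_norm)
  also have "\<dots> \<le> dist x g"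
    using xy by (auto simp: rounds_to_iff grid_def g_def)
  also have "\<dots> \<le> (\<Sum>j\<in>UNIV. \<bar>x $ j - g $ j\<bar>)"
    using norm_le_l1_cart[of "x - g"] by (simp add: dist_norm)
  also have "\<dots> \<le> (\<Sum>j\<in>(UNIV :: 'd set). h)"
    by (intro sum_mono g)
  finally show ?thesis by simp
qed

text \<open>A change of sign forces the determinant to move by at least its own absolute value,
  while rounding moves it by \<open>O(h)\<close>. As \<open>h \<le> 1\<close>, the rounded entries
  are at most \<open>1 + CARD('d)\<close> in absolute value, which is the \<open>R\<close>
  below.\<close>

lemma small_det_of_orientation_changed:
  "\<exists>K>0. \<forall>h x y. 0 < h \<longrightarrow> h \<le> 1 \<longrightarrow> (\<forall>k. norm (x k) \<le> 1) \<longrightarrow> (\<forall>k. rounds_to h (x k) (y k)) \<longrightarrow>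
     orientation y \<noteq> orientation x \<longrightarrow>
     \<bar>det (\<chi> k :: 'd::finite option. affine_lift (x k))\<bar> \<le> K * h"
proof -
  define R where "R = 1 + real CARD('d)"
  define K where "K = real (card {p. p permutes (UNIV :: 'd option set)}) *
    (R ^ CARD('d option) * (real CARD('d option) * (real CARD('d) / R)))"
  have R: "R > 0" by (simp add: R_def)
  \<comment> \<open>The summand 1 makes the constant visibly positive, so that it yields a positive
    threshold in the small-ball estimate.\<close>
  have "\<bar>det (\<chi> k. affine_lift (x k))\<bar> \<le> (K + 1) * h"
    if h: "0 < h" "h \<le> 1" and x: "\<And>k. norm (x k) \<le> 1" and xy: "\<And>k. rounds_to h (x k) (y k)"
      and ne: "orientation y \<noteq> orientation x" for h and x y :: "'d option \<Rightarrow> real ^ 'd"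
  proof -
    have diff: "\<bar>affine_lift (x k) $ j - affine_lift (y k) $ j\<bar> \<le> real CARD('d) * h" for k j
      using rounds_to_component_le[OF h(1) xy[of k]] h by (cases j) (auto simp: affine_lift_def)
    have bx: "\<bar>affine_lift (x k) $ j\<bar> \<le> 1" for k j
      using order_trans[OF component_le_norm_cart x[of k]] by (cases j) (auto simp: affine_lift_def)
    have by_R: "\<bar>affine_lift (y k) $ j\<bar> \<le> R" for k j
    proof -
      have "real CARD('d) * h \<le> real CARD('d)"
        using h by (simp add: mult_left_le)
      then show ?thesis
        using diff[of k j] bx[of k j] unfolding R_def by linarith
    qed
    have bx_R: "\<bar>affine_lift (x k) $ j\<bar> \<le> R" for k j
      using bx[of k j] by (simp add: R_def)
    have "\<bar>det (\<chi> k. affine_lift (x k)) - det (\<chi> k. affine_lift (y k))\<bar>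
      \<le> real (card {p. p permutes (UNIV :: 'd option set)}) *
        (R ^ CARD('d option) * (real CARD('d option) * (real CARD('d) * h / R)))"
      using R by (intro abs_det_diff_le) (auto simp: bx_R by_R diff)
    also have "\<dots> = K * h"
      by (simp add: K_def)
    finally have "\<bar>det (\<chi> k. affine_lift (x k)) - det (\<chi> k. affine_lift (y k))\<bar> \<le> K * h" .
    \<comment> \<open>Either one of the numbers is 0 or 0 lies between them.\<close>
    moreover have "\<bar>u\<bar> \<le> \<bar>u - v\<bar>" if "sgn v \<noteq> sgn u" for u v :: real
      using that by (auto simp: sgn_if split: if_splits)
    ultimately have "\<bar>det (\<chi> k. affine_lift (x k))\<bar> \<le> K * h"
      using ne unfolding orientation_eq_sgn_det by (meson order_trans)
    then show ?thesis
      using h by (simp add: distrib_right)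
  qed
  moreover have "K + 1 > 0"
    using R by (auto simp: K_def intro!: add_nonneg_pos mult_nonneg_nonneg)
  ultimately show ?thesis by blast
qed

section \<open>Index tuples and events of the sample\<close>

lemma countable_grid: "countable (grid h :: (real ^ 'd::finite) set)"
proof (rule countable_subset)
  show "grid h \<subseteq> range (\<lambda>z :: int ^ 'd. \<chi> j. h * of_int (z $ j))"
  proof
    fix x :: "real ^ 'd" assume "x \<in> grid h"
    then obtain z where "\<And>j. x $ j = h * of_int (z j)"
      unfolding grid_def by (auto simp: choice_iff)
    then have "x = (\<chi> j. h * of_int ((\<chi> j. z j) $ j))"
      by (simp add: vec_eq_iff)
    then show "x \<in> range (\<lambda>z :: int ^ 'd. \<chi> j. h * of_int (z $ j))"
      by blast
  qed
qed auto

lemma prob_space_uniform_sample: "prob_space (uniform_sample n :: (nat \<Rightarrow> real ^ 'd::finite) measure)"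
  unfolding uniform_sample_def by (intro prob_space_PiM prob_space_uniform_ball)

lemma measurable_uniform_sample_component:
  "i \<in> {1..n} \<Longrightarrow> (\<lambda>p. p i) \<in> borel_measurable (uniform_sample n :: (nat \<Rightarrow> real ^ 'd::finite) measure)"
  using measurable_component_singleton[of i "{1..n}" "\<lambda>_. uniform_ball :: (real ^ 'd) measure"]
  by (simp add: uniform_sample_def)

definition index_tuples :: "nat \<Rightarrow> ('d::finite option \<Rightarrow> nat) set" where
  "index_tuples n = {s. inj s \<and> range s \<subseteq> {1..n}}"

lemma index_tuples_range: "s \<in> index_tuples n \<Longrightarrow> s k \<in> {1..n}"
  unfolding index_tuples_def by blast

lemma index_tuples_subset: "index_tuples n \<subseteq> (\<Pi>\<^sub>E k\<in>UNIV. {1..n})"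
  by (auto simp: index_tuples_def PiE_UNIV_domain)

lemma finite_index_tuples: "finite (index_tuples n :: ('d::finite option \<Rightarrow> nat) set)"
  using index_tuples_subset by (rule finite_subset) (auto intro: finite_PiE)

text \<open>Counting all maps, injective or not; the grid step contains the matching power of
  \<open>n\<close>.\<close>

lemma card_index_tuples_le: "card (index_tuples n :: ('d::finite option \<Rightarrow> nat) set) \<le> n ^ (CARD('d) + 1)"
proof -
  have "card (index_tuples n :: ('d option \<Rightarrow> nat) set) \<le> card (\<Pi>\<^sub>E k\<in>(UNIV :: 'd option set). {1..n})"
    by (intro card_mono index_tuples_subset finite_PiE) auto
  then show ?thesis
    by (simp add: card_PiE)
qed

lemma same_chirotope_iff:
  "same_chirotope {1..n} p q \<longleftrightarrow>
    (\<forall>s\<in>index_tuples n. orientation (\<lambda>k. q (s k)) = orientation (\<lambda>k. p (s k)))"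
  by (auto simp: same_chirotope_def index_tuples_def)

text \<open>Allows a rounding to be replaced by its restriction to the sample indices.\<close>

lemma same_chirotope_cong:
  assumes "\<And>i. i \<in> I \<Longrightarrow> q i = q' i"
  shows "same_chirotope I p q \<longleftrightarrow> same_chirotope I p q'"
proof -
  have "(\<lambda>k. q (s k)) = (\<lambda>k. q' (s k))" if "range s \<subseteq> I" for s :: "'b option \<Rightarrow> 'a"
    using that assms by auto
  then show ?thesis
    unfolding same_chirotope_def by metis
qed

lemma measurable_det_sample:
  assumes "s \<in> index_tuples n"
  shows "(\<lambda>p. det (\<chi> k. affine_lift (p (s k)))) \<in>
    borel_measurable (uniform_sample n :: (nat \<Rightarrow> real ^ 'd::finite) measure)"
  unfolding minor_UNIV[of the, symmetric]
  by (intro measurable_minor measurable_uniform_sample_component index_tuples_range assms)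

lemma sets_Collect_Ball_countable:
  assumes "countable X" "\<And>i. i \<in> X \<Longrightarrow> {x \<in> space M. P i x} \<in> sets M"
  shows "{x \<in> space M. \<forall>i\<in>X. P i x} \<in> sets M"
proof (cases "X = {}")
  case False
  then have "{x \<in> space M. \<forall>i\<in>X. P i x} = (\<Inter>i\<in>X. {x \<in> space M. P i x})"
    by auto
  then show ?thesis
    using assms False by (auto intro!: sets.countable_INT')
qed auto

text \<open>The quantifier over all roundings is uncountable, but only their values on the sample matter,
  and these lie in the countable grid.\<close>

lemma sets_rounding_preserves_chirotope:
  "{p \<in> space (uniform_sample n). \<forall>p' :: nat \<Rightarrow> real ^ 'd::finite.
      (\<forall>i\<in>{1..n}. rounds_to h (p i) (p' i)) \<longrightarrow> same_chirotope {1..n} p p'} \<in> sets (uniform_sample n)"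
proof -
  let ?M = "uniform_sample n :: (nat \<Rightarrow> real ^ 'd) measure"
  let ?Q = "\<Pi>\<^sub>E i\<in>{1..n}. (grid h :: (real ^ 'd) set)"
  let ?ok = "\<lambda>p q :: nat \<Rightarrow> real ^ 'd. (\<forall>i\<in>{1..n}. rounds_to h (p i) (q i)) \<longrightarrow> same_chirotope {1..n} p q"
  have Q: "countable ?Q"
    by (intro countable_PiE countable_grid) auto
  have "{p \<in> space ?M. rounds_to h (p i) y} \<in> sets ?M" if i: "i \<in> {1..n}" for i y
  proof -
    have [measurable]: "(\<lambda>p. p i) \<in> borel_measurable ?M"
      using i by (rule measurable_uniform_sample_component)
    have "{p \<in> space ?M. dist (p i) y \<le> dist (p i) g} \<in> sets ?M" for g
      by measurable
    then have "{p \<in> space ?M. \<forall>g\<in>grid h. dist (p i) y \<le> dist (p i) g} \<in> sets ?M"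
      by (intro sets_Collect_Ball_countable countable_grid) auto
    then show ?thesis
      by (cases "y \<in> grid h") (auto simp: rounds_to_iff)
  qed
  then have 1: "{p \<in> space ?M. \<forall>i\<in>{1..n}. rounds_to h (p i) (q i)} \<in> sets ?M" for q
    by (intro sets_Collect_Ball_countable) auto
  have "{p \<in> space ?M. orientation (\<lambda>k. q (s k)) = orientation (\<lambda>k. p (s k))} \<in> sets ?M"
    if s: "s \<in> index_tuples n" for q and s :: "'d option \<Rightarrow> nat"
  proof -
    have [measurable]: "(\<lambda>p. det (\<chi> k. affine_lift (p (s k)))) \<in> borel_measurable ?M"
      using s by (rule measurable_det_sample)
    show ?thesis
      unfolding orientation_eq_sgn_det sgn_if by measurable
  qed
  then have 2: "{p \<in> space ?M. same_chirotope {1..n} p q} \<in> sets ?M" for q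
    unfolding same_chirotope_iff
    by (intro sets_Collect_Ball_countable countable_finite finite_index_tuples) auto
  have "{p \<in> space ?M. ?ok p q} \<in> sets ?M" for q
    by (intro sets.sets_Collect_imp 1 2)
  then have "{p \<in> space ?M. \<forall>q\<in>?Q. ?ok p q} \<in> sets ?M"
    by (intro sets_Collect_Ball_countable Q) auto
  moreover have "(\<forall>q\<in>?Q. ?ok p q) \<longleftrightarrow> (\<forall>q. ?ok p q)" for p
  proof (intro iffI allI impI)
    fix q assume all: "\<forall>q\<in>?Q. ?ok p q" and q: "\<forall>i\<in>{1..n}. rounds_to h (p i) (q i)"
    \<comment> \<open>On the sample indices every rounding agrees with a member of the countable set
      \<open>?Q\<close>.\<close>
    have "restrict q {1..n} \<in> ?Q"
      using q by (auto simp: rounds_to_iff)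
    then have "same_chirotope {1..n} p (restrict q {1..n})"
      using all q by auto
    then show "same_chirotope {1..n} p q"
      by (subst (asm) same_chirotope_cong[of _ _ q]) auto
  qed auto
  ultimately show ?thesis
    by simp
qed

text \<open>As \<open>s\<close> is injective, the selected points are again independent and uniform,
  so the small-ball estimate transfers to each tuple of the sample.\<close>

lemma emeasure_sample_tuple:
  assumes "s \<in> index_tuples n" and B: "B \<in> sets (PiM UNIV (\<lambda>_ :: 'd::finite option. uniform_ball))"
  shows "emeasure (uniform_sample n) {p \<in> space (uniform_sample n). (\<lambda>k. p (s k)) \<in> B}
    = emeasure (PiM UNIV (\<lambda>_ :: 'd option. uniform_ball :: (real ^ 'd) measure)) B"
proof -
  let ?M = "PiM {1..n} (\<lambda>_. uniform_ball :: (real ^ 'd) measure)"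
  let ?N = "PiM UNIV (\<lambda>_ :: 'd option. uniform_ball :: (real ^ 'd) measure)"
  have s: "inj s" "\<And>k. s k \<in> {1..n}"
    using assms index_tuples_range by (auto simp: index_tuples_def)
  have "distr ?M ?N (\<lambda>\<omega>. \<lambda>k\<in>UNIV. \<omega> (s k)) = ?N"
    using s by (intro distr_PiM_reindex prob_space_uniform_ball) auto
  then have "emeasure ?N B = emeasure (distr ?M ?N (\<lambda>\<omega>. \<lambda>k\<in>UNIV. \<omega> (s k))) B"
    by simp
  also have "\<dots> = emeasure ?M ((\<lambda>\<omega>. \<lambda>k\<in>UNIV. \<omega> (s k)) -` B \<inter> space ?M)"
    using s B by (intro emeasure_distr measurable_restrict measurable_component_singleton) auto
  also have "(\<lambda>\<omega>. \<lambda>k\<in>UNIV. \<omega> (s k)) -` B \<inter> space ?M = {p \<in> space ?M. (\<lambda>k. p (s k)) \<in> B}"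
    by (auto simp: restrict_def)
  finally show ?thesis
    by (simp add: uniform_sample_def)
qed

lemma AE_uniform_sample_norm_le:
  "AE p in (uniform_sample n :: (nat \<Rightarrow> real ^ 'd::finite) measure). \<forall>i\<in>{1..n}. norm (p i) \<le> 1"
proof -
  have "AE x in (uniform_ball :: (real ^ 'd) measure). norm x \<le> 1"
    unfolding uniform_ball_def by (rule AE_uniform_measureI) auto
  then have "AE p in (uniform_sample n :: (nat \<Rightarrow> real ^ 'd) measure). norm (p i) \<le> 1" if "i \<in> {1..n}" for i
    unfolding uniform_sample_def using that
    by (intro AE_PiM_component[where P = "\<lambda>x. norm x \<le> 1"] prob_space_uniform_ball) auto
  then show ?thesis
    by (intro AE_finite_allI) auto
qed

section \<open>Union bound over all tuples\<close>

theorem theorem3: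
  "\<exists>C::real. \<forall>\<epsilon>::real. \<epsilon> > 0 \<longrightarrow> (\<forall>n::nat. n \<ge> 1 \<longrightarrow>
     \<P>(p in (uniform_sample n :: (nat \<Rightarrow> real ^ 'd::finite) measure).
        \<forall>p' :: nat \<Rightarrow> real ^ 'd.
          (\<forall>i\<in>{1..n}. rounds_to (1 / real n powr (real CARD('d) + 1 + \<epsilon>)) (p i) (p' i)) \<longrightarrow>
          same_chirotope {1..n} p p')
       \<ge> 1 - C / real n powr \<epsilon>)"
proof -
  obtain C where C: "C \<ge> 0" and small_det: "\<And>\<delta>. \<delta> > 0 \<Longrightarrow>
      emeasure (PiM UNIV (\<lambda>_ :: 'd option. uniform_ball))
        {x. \<bar>det (\<chi> k. affine_lift (x k))\<bar> \<le> \<delta>} \<le> ennreal (C * \<delta>)"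
    using emeasure_small_det_le[where 'd = 'd] by blast
  obtain K where K: "K > 0" and changed: "\<And>h x y. 0 < h \<Longrightarrow> h \<le> 1 \<Longrightarrow> (\<And>k. norm (x k) \<le> 1) \<Longrightarrow>
      (\<And>k. rounds_to h (x k) (y k)) \<Longrightarrow> orientation y \<noteq> orientation x \<Longrightarrow>
      \<bar>det (\<chi> k :: 'd option. affine_lift (x k))\<bar> \<le> K * h"
    using small_det_of_orientation_changed[where 'd = 'd] by blast
  show ?thesis
  \<comment> \<open>\<open>C\<close> comes from the small-ball estimate and \<open>K\<close> from
    the rounding estimate. Both are fixed before \<epsilon> and \<open>n\<close>, so the constant
    depends on the dimension only.\<close>
  proof (intro exI[of _ "C * K"] allI impI)
    fix \<epsilon> :: real and n :: nat
    assume \<epsilon>: "\<epsilon> > 0" and n: "n \<ge> 1"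
    let ?M = "uniform_sample n :: (nat \<Rightarrow> real ^ 'd) measure"
    let ?S = "index_tuples n :: ('d option \<Rightarrow> nat) set"
    interpret prob_space ?M
      by (rule prob_space_uniform_sample)
    define h where "h = 1 / real n powr (real CARD('d) + 1 + \<epsilon>)"
    have h: "0 < h" "h \<le> 1"
      using n \<epsilon> by (auto simp: h_def ge_one_powr_ge_zero)
    define ok where "ok p \<longleftrightarrow> (\<forall>p'. (\<forall>i\<in>{1..n}. rounds_to h (p i) (p' i)) \<longrightarrow> same_chirotope {1..n} p p')"
      for p :: "nat \<Rightarrow> real ^ 'd"
    have ok: "{p \<in> space ?M. ok p} \<in> sets ?M"
      unfolding ok_def by (rule sets_rounding_preserves_chirotope)
    \<comment> \<open>Up to a null set, this event contains every sample in which some rounding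
      changes the orientation of the tuple \<open>s\<close>.\<close>
    define B where "B s = {p \<in> space ?M. \<bar>det (\<chi> k. affine_lift (p (s k)))\<bar> \<le> K * h}"
      for s :: "'d option \<Rightarrow> nat"
    have B_sets: "B s \<in> sets ?M" if "s \<in> ?S" for s
      using measurable_det_sample[OF that] unfolding B_def by measurable
    have B_le: "emeasure ?M (B s) \<le> ennreal (C * (K * h))" if "s \<in> ?S" for s
    proof -
      have "(\<lambda>x. det (\<chi> k. affine_lift (x k))) \<in> borel_measurable (PiM UNIV (\<lambda>_ :: 'd option. uniform_ball))"
        using measurable_minor[of UNIV "\<lambda>x. x" "PiM UNIV (\<lambda>_ :: 'd option. uniform_ball)" the]
        by (simp add: minor_UNIV)
      then have "{x \<in> space (PiM UNIV (\<lambda>_ :: 'd option. uniform_ball)). \<bar>det (\<chi> k. affine_lift (x k))\<bar> \<le> K * h}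
          \<in> sets (PiM UNIV (\<lambda>_ :: 'd option. uniform_ball))"
        by measurable
      then have "{x. \<bar>det (\<chi> k. affine_lift (x k))\<bar> \<le> K * h} \<in> sets (PiM UNIV (\<lambda>_ :: 'd option. uniform_ball))"
        by (simp add: space_PiM)
      from emeasure_sample_tuple[OF that this] show ?thesis
        using small_det[of "K * h"] K h by (simp add: B_def)
    qed
    \<comment> \<open>The inclusion holds where all sample points lie in the unit ball, which is
      almost sure.\<close>
    have "AE p in ?M. p \<in> {p \<in> space ?M. \<not> ok p} \<longrightarrow> p \<in> (\<Union>s\<in>?S. B s)"
      using AE_uniform_sample_norm_le
    proof eventually_elim
      case (elim p)
      show ?case
      proof
        assume p: "p \<in> {p \<in> space ?M. \<not> ok p}"
        then obtain p' where p': "\<And>i. i \<in> {1..n} \<Longrightarrow> rounds_to h (p i) (p' i)"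
          and "\<not> same_chirotope {1..n} p p'"
          unfolding ok_def by blast
        then obtain s where s: "s \<in> ?S" "orientation (\<lambda>k. p' (s k)) \<noteq> orientation (\<lambda>k. p (s k))"
          unfolding same_chirotope_iff by blast
        then have "s k \<in> {1..n}" for k
          by (intro index_tuples_range)
        then have "\<bar>det (\<chi> k. affine_lift (p (s k)))\<bar> \<le> K * h"
          using elim p' s h by (intro changed[of h _ "\<lambda>k. p' (s k)"]) auto
        then show "p \<in> (\<Union>s\<in>?S. B s)"
          using p s by (auto simp: B_def)
      qed
    qed
    then have "emeasure ?M {p \<in> space ?M. \<not> ok p} \<le> emeasure ?M (\<Union>s\<in>?S. B s)"
      using B_sets finite_index_tuples by (intro emeasure_mono_AE sets.finite_UN) auto
    also have "\<dots> \<le> (\<Sum>s\<in>?S. emeasure ?M (B s))"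
      using B_sets finite_index_tuples by (intro emeasure_subadditive_finite) auto
    also have "\<dots> \<le> (\<Sum>s\<in>?S. ennreal (C * (K * h)))"
      by (intro sum_mono B_le)
    also have "\<dots> = ennreal (real (card ?S) * (C * (K * h)))"
      using C K h by (simp add: ennreal_mult ennreal_of_nat_eq_real_of_nat)
    also have "\<dots> \<le> ennreal (real (n ^ (CARD('d) + 1)) * (C * (K * h)))"
      using C K h card_index_tuples_le[of n, where 'd = 'd]
      by (intro ennreal_leI mult_right_mono of_nat_mono) auto
    \<comment> \<open>The number of tuples cancels the power \<open>d + 1\<close> in
      \<open>h\<close>, leaving only the power \<epsilon>.\<close>
    also have "real (n ^ (CARD('d) + 1)) * (C * (K * h)) = C * K / real n powr \<epsilon>"
    proof -
      have "real (n ^ (CARD('d) + 1)) = real n powr (real CARD('d) + 1)"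
        using n by (simp add: powr_add powr_realpow)
      then show ?thesis
        using n by (simp add: h_def powr_add)
    qed
    finally have "prob {p \<in> space ?M. \<not> ok p} \<le> C * K / real n powr \<epsilon>"
      using C K by (simp add: emeasure_eq_measure)
    moreover have "prob {p \<in> space ?M. \<not> ok p} = 1 - prob {p \<in> space ?M. ok p}"
      using prob_neg[OF ok] by simp
    ultimately show "\<P>(p in ?M. \<forall>p'. (\<forall>i\<in>{1..n}. rounds_to (1 / real n powr (real CARD('d) + 1 + \<epsilon>)) (p i) (p' i)) \<longrightarrow>
          same_chirotope {1..n} p p') \<ge> 1 - C * K / real n powr \<epsilon>"
      unfolding ok_def h_def by simp
  qed
qed

end
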